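(* Let $n\ge 1$ and let $a_1,\dots,a_n$ be pairwise relatively prime positive integers. For a positive integer $t$ let $$p_A'(t)=\#\Big\{(m_1,\dots,m_n)\in\mathbb Z_{>0}^n:\ \sum_{k=1}^n m_ka_k=t\Big\}.$$ Then for every positive integer $t$, $$p_A'(t)=R'_t(a_1,\dots,a_n)+\sum_{j=1}^n\sigma_t(a_1,\dots,\hat a_j,\dots,a_n;a_j),$$ where $\hat a_j$ means that the entry $a_j$ is omitted, and $R'_t(a_1,\dots,a_n)=\operatorname{Res}(G_t(z),z=1)$ with $$G_t(z)=\frac{z^{t-1}}{(z^{a_1}-1)\cdots(z^{a_n}-1)}.$$
   Context: Fourier-Dedekind sum: for integers $c_1,\dots,c_m$ each relatively prime to a positive integer $c$, and $t\in\mathbb Z$, $$\sigma_t(c_1,\dots,c_m;c)=\frac1c\sum_{\lambda^c=1,\ \lambda\ne1}\frac{\lambda^t}{(\lambda^{c_1}-1)\cdots(\lambda^{c_m}-1)},$$ the sum being over all complex $c$-th roots of unity $\lambda\neq 1$ (so it is $0$ if $c=1$); an empty product in the denominator is $1$. $\operatorname{Res}(G(z),z=1)$ denotes the residue of the meromorphic function $G$ at $z=1$. *)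

theory Defs
  imports "HOL-Complex_Analysis.Complex_Analysis" "HOL-Library.FuncSet"
begin

text \<open>
  Tuples are families over a finite index set, so that omitting the entry with index \<open>j\<close> from
  \<open>(a k)\<close>, \<open>k \<in> I\<close>, amounts to using the index set \<open>I - {j}\<close>.
\<close>

text \<open>
  The sum \<open>\<sigma>\<^sub>t(c\<^sub>1, \<dots>, c\<^sub>m; b)\<close>, where the \<open>c\<^sub>i\<close> are the values of \<open>c\<close> on \<open>I\<close>. It is meant for
  \<open>b > 0\<close> and every \<open>c i\<close> (with \<open>i \<in> I\<close>) coprime to \<open>b\<close>; then the set of roots of unity is
  finite and no denominator vanishes.
\<close>

definition fourier_dedekind :: "int \<Rightarrow> 'i set \<Rightarrow> ('i \<Rightarrow> int) \<Rightarrow> nat \<Rightarrow> complex" where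
  "fourier_dedekind t I c b =
     1 / of_nat b *
     (\<Sum>w\<in>{w. w ^ b = 1 \<and> w \<noteq> 1}. w powi t / (\<Prod>i\<in>I. w powi c i - 1))"

text \<open>
  The functions are extensional (\<open>\<rightarrow>\<^sub>E\<close>), so each tuple \<open>(m\<^sub>1, \<dots>, m\<^sub>n)\<close> is counted once.
\<close>

definition pos_solutions :: "nat \<Rightarrow> (nat \<Rightarrow> nat) \<Rightarrow> nat \<Rightarrow> (nat \<Rightarrow> nat) set" where
  "pos_solutions n a t = {m \<in> {1..n} \<rightarrow>\<^sub>E {0<..}. (\<Sum>k=1..n. m k * a k) = t}"

definition pos_partition_count :: "nat \<Rightarrow> (nat \<Rightarrow> nat) \<Rightarrow> nat \<Rightarrow> nat" where
  "pos_partition_count n a t = card (pos_solutions n a t)"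

lemma finite_pos_solutions:
  assumes "\<And>k. k \<in> {1..n} \<Longrightarrow> a k > 0"
  shows "finite (pos_solutions n a t)"
proof (rule finite_subset)
  show "pos_solutions n a t \<subseteq> {1..n} \<rightarrow>\<^sub>E {..t}"
  proof
    fix m assume m: "m \<in> pos_solutions n a t"
    have "m k \<le> t" if k: "k \<in> {1..n}" for k
    proof -
      have "m k \<le> m k * a k" using assms[OF k] by simp
      also have "\<dots> \<le> (\<Sum>k=1..n. m k * a k)" by (rule member_le_sum[OF k]) auto
      also have "\<dots> = t" using m by (simp add: pos_solutions_def)
      finally show ?thesis .
    qed
    then show "m \<in> {1..n} \<rightarrow>\<^sub>E {..t}"
      using m by (auto simp: pos_solutions_def PiE_iff)
  qed
  show "finite ({1..n} \<rightarrow>\<^sub>E {..t})" by (intro finite_PiE) auto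
qed

definition gen_G :: "nat \<Rightarrow> (nat \<Rightarrow> nat) \<Rightarrow> nat \<Rightarrow> complex \<Rightarrow> complex" where
  "gen_G n a t z = z powi (int t - 1) / (\<Prod>k=1..n. z ^ a k - 1)"

definition res_term :: "nat \<Rightarrow> (nat \<Rightarrow> nat) \<Rightarrow> nat \<Rightarrow> complex" where
  "res_term n a t = residue (gen_G n a t) 1"

end

theory Submission
  imports Defs
begin

text \<open>
  Integrate \<open>G\<^sub>t\<close> over a circle \<open>\<bar>z\<bar> = R\<close> with \<open>R > 1\<close>. By the residue theorem the integral is
  \<open>2\<pi>\<i>\<close> times the sum of all residues: the one at \<open>1\<close>, and those at the nontrivial \<open>a\<^sub>j\<close>-th roots
  of unity, which are simple poles by coprimality and give the Fourier-Dedekind sums. On the other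
  hand, the integral is \<open>2\<pi>\<i>\<close> times the number of solutions: expanding one factor as
  \<open>1 / (z\<^sup>a - 1) = z\<^sup>-\<^sup>a + z\<^sup>-\<^sup>a / (z\<^sup>a - 1)\<close> repeatedly gives the recursion satisfied by the
  counts, because the integral does not depend on \<open>R\<close> and, for \<open>t \<le> 0\<close> and at least one factor,
  tends to \<open>0\<close> as \<open>R \<rightarrow> \<infinity>\<close>. The recursion lowers \<open>t\<close> below \<open>0\<close>, so \<open>t\<close> has to range over the
  integers and \<open>0\<close> has to be included among the possible poles.
\<close>

text \<open>An arbitrary index set replaces \<open>{1..n}\<close> so that inductions can add one
  factor at a time.\<close>

definition sols :: "'i set \<Rightarrow> ('i \<Rightarrow> nat) \<Rightarrow> int \<Rightarrow> ('i \<Rightarrow> nat) set" where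
  "sols S a t = {m \<in> S \<rightarrow>\<^sub>E {0<..}. (\<Sum>k\<in>S. int (m k * a k)) = t}"

definition gen_fun :: "'i set \<Rightarrow> ('i \<Rightarrow> nat) \<Rightarrow> int \<Rightarrow> complex \<Rightarrow> complex" where
  "gen_fun S a t z = z powi (t - 1) / (\<Prod>k\<in>S. z ^ a k - 1)"

definition root_poles :: "'i set \<Rightarrow> ('i \<Rightarrow> nat) \<Rightarrow> complex set" where
  "root_poles S a = (\<Union>k\<in>S. {w. w ^ a k = 1})"

section \<open>Recursion for the number of solutions\<close>

lemma sols_empty: "sols {} a t = (if t = 0 then {\<lambda>_. undefined} else {})"
  by (auto simp: sols_def)

text \<open>Solutions are sorted by their value \<open>m\<close> at the new index. Since
  \<open>a k \<ge> 1\<close> and the other summands are nonnegative, \<open>m\<close> never exceeds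
  \<open>t\<close>, so a finite range suffices.\<close>

lemma sols_insert:
  assumes "finite S" "k \<notin> S" "a k > 0"
  shows "sols (insert k S) a t =
    (\<Union>m\<in>{1..nat t}. (\<lambda>f. f(k := m)) ` sols S a (t - int (m * a k)))" (is "?L = ?R")
proof (intro equalityI subsetI)
  fix f assume f: "f \<in> ?L"
  \<comment> \<open>Resetting the value at \<open>k\<close> makes \<open>g\<close> extensional on
    \<open>S\<close>.\<close>
  define g where "g = f(k := undefined)"
  have sum: "t = int (f k * a k) + (\<Sum>i\<in>S. int (f i * a i))" and fk: "f k \<ge> 1"
    using f assms by (auto simp: sols_def PiE_iff Suc_le_eq)
  have gs: "(\<Sum>i\<in>S. int (g i * a i)) = (\<Sum>i\<in>S. int (f i * a i))"
    using assms by (intro sum.cong) (auto simp: g_def)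
  have "int (f k) \<le> int (f k * a k)"
    using assms(3) by (metis of_nat_le_iff mult.right_neutral mult_le_mono2 Suc_leI One_nat_def)
  also have "\<dots> \<le> t"
    unfolding sum by (simp add: sum_nonneg)
  finally have "f k \<in> {1..nat t}"
    using fk by auto
  moreover have "g \<in> sols S a (t - int (f k * a k))"
    using f assms sum gs by (auto simp: sols_def PiE_iff g_def extensional_def)
  moreover have "f = g(k := f k)"
    by (simp add: g_def)
  ultimately show "f \<in> ?R"
    by blast
next
  fix f assume "f \<in> ?R"
  then obtain m g where m: "m \<in> {1..nat t}" and g: "g \<in> sols S a (t - int (m * a k))"
    and f: "f = g(k := m)"
    by blast
  have "(\<Sum>i\<in>S. int (f i * a i)) = (\<Sum>i\<in>S. int (g i * a i))"
    using assms by (intro sum.cong) (auto simp: f)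
  then show "f \<in> ?L"
    using m g assms by (auto simp: sols_def PiE_iff f extensional_def)
qed

lemma finite_sols:
  assumes "finite S" "\<And>k. k \<in> S \<Longrightarrow> a k > 0"
  shows "finite (sols S a t)"
  using assms
proof (induction S arbitrary: t rule: finite_induct)
  case (insert k S)
  then show ?case
    unfolding sols_insert[of S k a, OF insert.hyps insert.prems[OF insertI1]] by auto
qed (simp add: sols_empty)

lemma card_sols_insert:
  assumes "finite S" "k \<notin> S" "\<And>i. i \<in> insert k S \<Longrightarrow> a i > 0"
  shows "card (sols (insert k S) a t) = (\<Sum>m=1..nat t. card (sols S a (t - int (m * a k))))"
proof -
  have "card (sols (insert k S) a t) =
      (\<Sum>m=1..nat t. card ((\<lambda>f. f(k := m)) ` sols S a (t - int (m * a k))))"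
    unfolding sols_insert[of S k a, OF assms(1,2) assms(3)[OF insertI1]]
  proof (intro card_UN_disjoint ballI impI)
    show "finite ((\<lambda>f. f(k := m)) ` sols S a (t - int (m * a k)))" for m
      using assms by (intro finite_imageI finite_sols) auto
  \<comment> \<open>Members of the images for distinct \<open>m\<close> differ at \<open>k\<close>,
    so the images are disjoint.\<close>
  qed (auto dest: fun_cong[of _ _ k])
  also have "\<dots> = (\<Sum>m=1..nat t. card (sols S a (t - int (m * a k))))"
  proof (intro sum.cong refl card_image inj_onI)
    fix m f g
    assume *: "f \<in> sols S a (t - int (m * a k))" "g \<in> sols S a (t - int (m * a k))"
      "f(k := m) = g(k := m)"
    \<comment> \<open>As \<open>k\<close> lies outside \<open>S\<close>, both values are
      \<open>undefined\<close>.\<close>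
    have "f k = g k"
      using * assms(2) by (auto simp: sols_def PiE_iff extensional_def)
    with *(3) show "f = g"
      by (metis fun_upd_triv fun_upd_upd)
  qed
  finally show ?thesis .
qed

section \<open>Poles on the unit circle and the residue theorem\<close>

lemma norm_root_poles:
  assumes "\<And>k. k \<in> S \<Longrightarrow> a k > 0" "w \<in> root_poles S a"
  shows "norm w = 1"
proof -
  obtain k where "k \<in> S" "w ^ a k = 1"
    using assms(2) by (auto simp: root_poles_def)
  then have "norm w ^ a k = 1" "a k > 0"
    using assms(1) by (auto simp flip: norm_power)
  then show ?thesis
    using power_eq_1_iff by force
qed

lemma finite_root_poles:
  assumes "finite S" "\<And>k. k \<in> S \<Longrightarrow> a k > 0"
  shows "finite (root_poles S a)"
  unfolding root_poles_def using assms by (intro finite_UN_I finite_roots_unity) (auto simp: Suc_le_eq)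

lemma gen_fun_holomorphic:
  assumes "finite S"
  shows "gen_fun S a t holomorphic_on - insert 0 (root_poles S a)"
  unfolding gen_fun_def[abs_def] using assms
  by (intro holomorphic_intros) (auto simp: root_poles_def)

text \<open>A circle with \<open>R > 1\<close> winds exactly once around every candidate pole. The
  right-hand side is free of \<open>R\<close>, which later gives independence of the radius.\<close>

lemma contour_integral_gen_fun:
  assumes "finite S" "\<And>k. k \<in> S \<Longrightarrow> a k > 0" "R > 1"
  shows "contour_integral (circlepath 0 R) (gen_fun S a t) =
    2 * pi * \<i> * (\<Sum>w\<in>insert 0 (root_poles S a). residue (gen_fun S a t) w)"
proof -
  let ?P = "insert 0 (root_poles S a)"
  have norm: "norm w < R" if "w \<in> ?P" for w
    using that norm_root_poles[of S a w, OF assms(2)] assms(3) by force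
  have "contour_integral (circlepath 0 R) (gen_fun S a t) =
      2 * pi * \<i> * (\<Sum>w\<in>?P. winding_number (circlepath 0 R) w * residue (gen_fun S a t) w)"
  proof (rule Residue_theorem[of UNIV])
    show "gen_fun S a t holomorphic_on UNIV - ?P"
      using gen_fun_holomorphic[OF assms(1)] by (simp add: Compl_eq_Diff_UNIV)
    show "path_image (circlepath 0 R) \<subseteq> UNIV - ?P"
      using norm assms(3) by fastforce
  qed (use assms finite_root_poles in auto)
  also have "(\<Sum>w\<in>?P. winding_number (circlepath 0 R) w * residue (gen_fun S a t) w) =
      (\<Sum>w\<in>?P. residue (gen_fun S a t) w)"
    by (intro sum.cong refl) (simp add: winding_number_circlepath norm)
  finally show ?thesis .
qed

section \<open>Integrability and decay on large circles\<close>

lemma gen_fun_contour_integrable: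
  assumes "finite S" "\<And>k. k \<in> S \<Longrightarrow> a k > 0" "R > 1"
  shows "gen_fun S a t contour_integrable_on circlepath 0 R"
proof (rule contour_integrable_continuous_circlepath)
  have "w \<notin> insert 0 (root_poles S a)" if "norm w = R" for w
    using that norm_root_poles[of S a w, OF assms(2)] assms(3) by auto
  then have "path_image (circlepath 0 R) \<subseteq> - insert 0 (root_poles S a)"
    using assms(3) by auto
  then show "continuous_on (path_image (circlepath 0 R)) (gen_fun S a t)"
    using gen_fun_holomorphic[OF assms(1)] continuous_on_subset holomorphic_on_imp_continuous_on
    by blast
qed

text \<open>Every factor has norm at least \<open>norm z - 1 \<ge> 1\<close>. For
  \<open>t < 0\<close> the power of \<open>z\<close> alone decays quadratically; for
  \<open>t = 0\<close> it decays only linearly, and one factor, of norm at least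
  \<open>norm z / 2\<close>, supplies the rest. This is where \<open>S \<noteq> {}\<close> enters
  and where the constant 2 comes from.\<close>

lemma norm_gen_fun_le:
  assumes "finite S" "\<And>k. k \<in> S \<Longrightarrow> a k > 0" "norm z \<ge> 2"
    and "t < 0 \<or> t = 0 \<and> S \<noteq> {}"
  shows "norm (gen_fun S a t z) \<le> 2 / norm z ^ 2"
proof -
  let ?R = "norm z"
  have factor: "?R - 1 \<le> norm (z ^ a k - 1)" if "k \<in> S" for k
  proof -
    have "?R ^ 1 \<le> ?R ^ a k"
      using assms(2)[OF that] assms(3) by (intro power_increasing) auto
    then show ?thesis
      using norm_triangle_ineq2[of "z ^ a k" 1] by (simp add: norm_power)
  qed
  have one: "1 \<le> norm (\<Prod>k\<in>T. z ^ a k - 1)" if "T \<subseteq> S" for T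
    unfolding prod_norm[symmetric] using factor that assms(3) by (intro prod_ge_1) force
  consider "t < 0" | "t = 0" "S \<noteq> {}"
    using assms(4) by blast
  then show ?thesis
  proof cases
    case 1
    have "norm (gen_fun S a t z) = ?R powi (t - 1) / norm (\<Prod>k\<in>S. z ^ a k - 1)"
      by (simp add: gen_fun_def norm_divide norm_power_int)
    also have "\<dots> \<le> ?R powi (- 2) / 1"
      using 1 assms(3) one[of S] by (intro frac_le power_int_increasing) auto
    also have "\<dots> \<le> 2 / ?R ^ 2"
      by (simp add: power_int_minus inverse_eq_divide divide_right_mono)
    finally show ?thesis .
  next
    case 2
    then obtain k where k: "k \<in> S"
      by blast
    have "?R / 2 * 1 \<le> norm (z ^ a k - 1) * norm (\<Prod>i\<in>S - {k}. z ^ a i - 1)"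
      using factor[OF k] one[of "S - {k}"] assms(3) by (intro mult_mono) auto
    also have "\<dots> = norm (\<Prod>i\<in>S. z ^ a i - 1)"
      by (simp add: prod.remove[OF assms(1) k] norm_mult)
    finally have ge: "?R / 2 \<le> norm (\<Prod>i\<in>S. z ^ a i - 1)"
      by simp
    have "norm (gen_fun S a t z) = inverse ?R / norm (\<Prod>k\<in>S. z ^ a k - 1)"
      using 2 by (simp add: gen_fun_def norm_divide norm_inverse power_int_minus)
    also have "\<dots> \<le> inverse ?R / (?R / 2)"
      using ge assms(3) by (intro frac_le) auto
    also have "\<dots> = 2 / ?R ^ 2"
      by (simp add: field_simps power2_eq_square)
    finally show ?thesis .
  qed
qed

lemma contour_integral_gen_fun_eq_0:
  assumes "finite S" "\<And>k. k \<in> S \<Longrightarrow> a k > 0" "R > 1"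
    and "t < 0 \<or> t = 0 \<and> S \<noteq> {}"
  shows "contour_integral (circlepath 0 R) (gen_fun S a t) = 0"
proof -
  define I where "I = contour_integral (circlepath 0 R) (gen_fun S a t)"
  have bound: "norm I \<le> 4 * pi / r" if r: "r \<ge> 2" for r
  proof -
    \<comment> \<open>The radii \<open>R\<close> and \<open>r\<close> give the same sum of residues,
      hence the same integral \<open>I\<close>.\<close>
    have "(gen_fun S a t has_contour_integral I) (circlepath 0 r)"
      using has_contour_integral_integral[OF gen_fun_contour_integrable[of S a r t, OF assms(1,2)]] r
        contour_integral_gen_fun[of S a _ t, OF assms(1,2)] assms(3) by (simp add: I_def)
    then have "norm I \<le> 2 / r ^ 2 * (2 * pi * r)"
    proof (rule has_contour_integral_bound_circlepath)
      fix z :: complex assume "norm (z - 0) = r"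
      then show "norm (gen_fun S a t z) \<le> 2 / r ^ 2"
        using norm_gen_fun_le[of S a z t, OF assms(1,2) _ assms(4)] r by auto
    qed (use r in auto)
    then show ?thesis
      using r by (simp add: field_simps power2_eq_square)
  qed
  have "((\<lambda>r. 4 * pi / r) \<longlongrightarrow> 0) at_top"
    by real_asymp
  then have "norm I \<le> 0"
    using bound by (intro tendsto_lowerbound[of "\<lambda>r. 4 * pi / r" 0 at_top])
      (auto simp: eventually_at_top_linorder)
  then show ?thesis
    by (simp add: I_def)
qed

section \<open>Recursion for the contour integral\<close>

lemma gen_fun_insert:
  assumes "finite S" "k \<notin> S" "z \<noteq> 0" "z ^ a k \<noteq> 1"
  shows "gen_fun (insert k S) a t z =
    gen_fun S a (t - int (a k)) z + gen_fun (insert k S) a (t - int (a k)) z"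
proof -
  have "z powi (t - 1) = z powi (t - int (a k) - 1) * z ^ a k"
    using assms(3) by (simp flip: power_int_add power_int_of_nat)
  \<comment> \<open>Here \<open>v\<close> stands for \<open>z ^ a k\<close> and \<open>p\<close> for
    the product over \<open>S\<close>. That product may vanish at \<open>z\<close>; both sides are
    then 0 because division by zero yields 0.\<close>
  moreover have "w * v / (p * (v - 1)) = w / p + w / (p * (v - 1))" if "v \<noteq> 1" for w v p :: complex
    using that by (cases "p = 0") (auto simp: field_simps)
  ultimately show ?thesis
    using assms by (simp add: gen_fun_def mult.commute[of "z ^ a k - 1"])
qed

text \<open>The expansion of the factor for \<open>k\<close> is iterated \<open>M\<close> times. The
  last integral is the remainder, which vanishes once \<open>M\<close> is large enough.\<close>

lemma contour_integral_gen_fun_insert: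
  assumes "finite S" "k \<notin> S" "\<And>i. i \<in> insert k S \<Longrightarrow> a i > 0" "R > 1"
  shows "contour_integral (circlepath 0 R) (gen_fun (insert k S) a t) =
    (\<Sum>m=1..M. contour_integral (circlepath 0 R) (gen_fun S a (t - int (m * a k)))) +
    contour_integral (circlepath 0 R) (gen_fun (insert k S) a (t - int (M * a k)))"
proof (induction M)
  case (Suc M)
  let ?I = "contour_integral (circlepath 0 R)" and ?s = "t - int (M * a k)"
  have "?I (gen_fun (insert k S) a ?s) =
      ?I (\<lambda>z. gen_fun S a (?s - int (a k)) z + gen_fun (insert k S) a (?s - int (a k)) z)"
  proof (intro contour_integral_cong refl gen_fun_insert assms)
    fix z assume "z \<in> path_image (circlepath 0 R)"
    then have z: "norm z = R"
      using assms(4) by simp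
    then show "z \<noteq> 0"
      using assms(4) by auto
    show "z ^ a k \<noteq> 1"
      using norm_root_poles[of "insert k S" a z, OF assms(3)] z assms(4) by (auto simp: root_poles_def)
  qed
  also have "\<dots> = ?I (gen_fun S a (?s - int (a k))) + ?I (gen_fun (insert k S) a (?s - int (a k)))"
    using assms by (intro contour_integral_add gen_fun_contour_integrable) auto
  finally show ?case
    using Suc.IH by (simp add: algebra_simps)
qed simp

section \<open>The contour integral counts solutions\<close>

lemma gen_fun_holomorphic_ball:
  assumes "finite S" "\<And>k. k \<in> S \<Longrightarrow> a k > 0" "t > 0"
  shows "gen_fun S a t holomorphic_on ball 0 1"
  unfolding gen_fun_def[abs_def] using assms norm_root_poles[of S a]
  by (intro holomorphic_intros) (force simp: root_poles_def)+

text \<open>For \<open>t > 0\<close> the exponent \<open>t - 1\<close> is nonnegative, so 0 is not a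
  pole.\<close>

lemma residue_gen_fun_0:
  assumes "finite S" "\<And>k. k \<in> S \<Longrightarrow> a k > 0" "t > 0"
  shows "residue (gen_fun S a t) 0 = 0"
  using gen_fun_holomorphic_ball[OF assms] by (intro residue_holo[of "ball 0 1"]) auto

text \<open>Counts and integrals satisfy the same recursion in the index set. In the base case the
  integrand is a pure power of \<open>z\<close>, whose integral is nonzero only for exponent -1,
  that is \<open>t = 0\<close>, when the empty tuple is the one solution.\<close>

lemma contour_integral_gen_fun_eq_card:
  assumes "finite S" "\<And>k. k \<in> S \<Longrightarrow> a k > 0" "R > 1"
  shows "contour_integral (circlepath 0 R) (gen_fun S a t) =
    2 * pi * \<i> * of_nat (card (sols S a t))"
  using assms(1,2)
proof (induction S arbitrary: t rule: finite_induct)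
  case empty
  consider "t < 0" | "t = 0" | "t > 0" by linarith
  then show ?case
  proof cases
    case 1
    then show ?thesis
      using contour_integral_gen_fun_eq_0[of "{}" a R t] assms(3) by (simp add: sols_empty)
  next
    case 2
    have "((\<lambda>u. 1 / (u - 0)) has_contour_integral 2 * pi * \<i> * 1) (circlepath 0 R)"
      using assms(3) Cauchy_integral_circlepath_simple[of "\<lambda>_. 1" 0 R 0] by simp
    then show ?thesis
      using 2 by (auto simp: sols_empty gen_fun_def[abs_def] power_int_minus divide_inverse
          dest: contour_integral_unique)
  next
    case 3
    then show ?thesis
      using contour_integral_gen_fun[of "{}" a R t] residue_gen_fun_0[of "{}" a t] assms(3)
      by (simp add: sols_empty root_poles_def)
  qed
next
  case (insert k S)
  let ?I = "contour_integral (circlepath 0 R)"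
  \<comment> \<open>Since \<open>a k \<ge> 1\<close>, \<open>nat t\<close> expansions bring the
    parameter down to at most 0, where the remainder vanishes because \<open>insert k S\<close> is
    nonempty.\<close>
  have "int (nat t * 1) \<le> int (nat t * a k)"
    using insert.prems[of k] by (subst of_nat_le_iff, intro mult_le_mono2) auto
  then have "t - int (nat t * a k) \<le> 0"
    by linarith
  then have "?I (gen_fun (insert k S) a (t - int (nat t * a k))) = 0"
    using insert.hyps insert.prems assms(3) by (intro contour_integral_gen_fun_eq_0) auto
  then have "?I (gen_fun (insert k S) a t) =
      (\<Sum>m=1..nat t. ?I (gen_fun S a (t - int (m * a k))))"
    using contour_integral_gen_fun_insert[of S k a R t "nat t", OF insert.hyps insert.prems assms(3)] by simp
  also have "\<dots> = (\<Sum>m=1..nat t. 2 * pi * \<i> * of_nat (card (sols S a (t - int (m * a k)))))"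
    using insert.IH insert.prems by (intro sum.cong) auto
  also have "\<dots> = 2 * pi * \<i> * of_nat (card (sols (insert k S) a t))"
    using card_sols_insert[of S k a t, OF insert.hyps insert.prems] by (simp add: sum_distrib_left)
  finally show ?case .
qed

section \<open>Residues at roots of unity and Fourier-Dedekind sums\<close>

lemma coprime_roots_unity_eq_1:
  fixes w :: complex
  assumes "coprime a b" "w ^ a = 1" "w ^ b = 1"
  shows "w = 1"
proof (cases "a = 0")
  case True
  then show ?thesis using assms by simp
next
  case False
  then obtain x y where "a * x = b * y + 1"
    using bezout_nat[of a b] assms(1) by auto
  then have "(w ^ a) ^ x = (w ^ b) ^ y * w"
    by (metis power_mult power_add power_one_right)
  then show ?thesis
    using assms by simp
qed

text \<open>Only the factor for \<open>j\<close> vanishes at \<open>w\<close>, so the pole is simple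
  and the residue is \<open>?f w\<close> divided by the derivative of \<open>?g\<close> at
  \<open>w\<close>. That derivative equals \<open>a j / w\<close>, which raises the exponent from
  \<open>t - 1\<close> to \<open>t\<close>.\<close>

lemma residue_gen_fun_root:
  assumes "finite S" "j \<in> S" "a j > 0" "w ^ a j = 1"
    and "\<And>i. i \<in> S - {j} \<Longrightarrow> w ^ a i \<noteq> 1"
  shows "residue (gen_fun S a t) w = w powi t / (of_nat (a j) * (\<Prod>i\<in>S - {j}. w ^ a i - 1))"
proof -
  let ?f = "\<lambda>z. z powi (t - 1) / (\<Prod>i\<in>S - {j}. z ^ a i - 1)" and ?g = "\<lambda>z. z ^ a j - 1"
  \<comment> \<open>On this open set the cofactor \<open>?f\<close> is holomorphic.\<close>
  let ?U = "{z. z \<noteq> 0 \<and> (\<Prod>i\<in>S - {j}. z ^ a i - 1) \<noteq> (0 :: complex)}"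
  have w0: "w \<noteq> 0"
    using assms(3,4) by (auto simp: power_0_left)
  have open_U: "open ?U"
    by (intro open_Collect_conj open_Collect_neq continuous_intros)
  have wU: "w \<in> ?U"
    using assms w0 by auto
  obtain e where e: "e > 0" "ball w e \<subseteq> ?U"
    using open_U wU open_contains_ball by blast
  have "residue (\<lambda>z. ?f z / ?g z) w = ?f w / (of_nat (a j) * w ^ (a j - 1))"
  proof (rule residue_simple_pole_deriv[where s = "ball w e"])
    show "?f holomorphic_on ball w e"
      using e by (intro holomorphic_intros) auto
    show "(?g has_field_derivative of_nat (a j) * w ^ (a j - 1)) (at w)"
      by (auto intro!: derivative_eq_intros)
    show "of_nat (a j) * w ^ (a j - 1) \<noteq> 0"
      using assms(3) w0 by auto
    show "?f w \<noteq> 0"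
      using wU by auto
  qed (use e assms in \<open>auto intro!: holomorphic_intros\<close>)
  also have "(\<lambda>z. ?f z / ?g z) = gen_fun S a t"
    by (auto simp: gen_fun_def prod.remove[OF assms(1,2)] fun_eq_iff)
  also have "w ^ (a j - 1) = inverse w"
    using assms(3,4) w0 by (simp add: power_diff inverse_eq_divide)
  also have "?f w / (of_nat (a j) * inverse w) =
      w powi t / (of_nat (a j) * (\<Prod>i\<in>S - {j}. w ^ a i - 1))"
    using w0 by (simp add: power_int_diff field_simps)
  finally show ?thesis .
qed

text \<open>By coprimality a nontrivial root of unity annihilates exactly one factor, so the poles
  other than 1 split into disjoint sets \<open>?Z j\<close>, each contributing one Fourier-Dedekind
  sum.\<close>

lemma sum_residue_gen_fun:
  assumes "finite S" "S \<noteq> {}" "\<And>k. k \<in> S \<Longrightarrow> a k > 0"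
    and coprime: "\<And>i j. i \<in> S \<Longrightarrow> j \<in> S \<Longrightarrow> i \<noteq> j \<Longrightarrow> coprime (a i) (a j)"
  shows "(\<Sum>w\<in>root_poles S a. residue (gen_fun S a t) w) =
    residue (gen_fun S a t) 1 + (\<Sum>j\<in>S. fourier_dedekind t (S - {j}) (\<lambda>k. int (a k)) (a j))"
proof -
  let ?Z = "\<lambda>j. {w :: complex. w ^ a j = 1 \<and> w \<noteq> 1}"
  have fin: "finite (?Z j)" if "j \<in> S" for j
    using finite_roots_unity[of "a j"] assms(3)[OF that] by (auto simp: Suc_le_eq)
  \<comment> \<open>The point 1 is a root of every factor; nonemptiness of \<open>S\<close> makes it
    a candidate pole.\<close>
  have decomp: "root_poles S a = insert 1 (\<Union>j\<in>S. ?Z j)"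
    using assms(2) by (auto simp: root_poles_def)
  have disj: "w ^ a i \<noteq> 1" if "w \<in> ?Z j" "j \<in> S" "i \<in> S - {j}" for w i j
    using coprime_roots_unity_eq_1[OF coprime[of i j], of w] that by auto
  have "(\<Sum>w\<in>root_poles S a. residue (gen_fun S a t) w) =
      residue (gen_fun S a t) 1 + (\<Sum>w\<in>(\<Union>j\<in>S. ?Z j). residue (gen_fun S a t) w)"
    unfolding decomp using assms(1) fin by (subst sum.insert) auto
  also have "(\<Sum>w\<in>(\<Union>j\<in>S. ?Z j). residue (gen_fun S a t) w) =
      (\<Sum>j\<in>S. \<Sum>w\<in>?Z j. residue (gen_fun S a t) w)"
    using assms(1) fin disj by (intro sum.UNION_disjoint) blast+
  also have "\<dots> = (\<Sum>j\<in>S. fourier_dedekind t (S - {j}) (\<lambda>k. int (a k)) (a j))"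
  proof (intro sum.cong refl)
    fix j assume j: "j \<in> S"
    have "(\<Sum>w\<in>?Z j. residue (gen_fun S a t) w) =
        (\<Sum>w\<in>?Z j. 1 / of_nat (a j) * (w powi t / (\<Prod>i\<in>S - {j}. w ^ a i - 1)))"
      using disj[OF _ j] assms(1) j assms(3)[OF j]
      by (intro sum.cong refl) (subst residue_gen_fun_root[where j = j], auto)
    then show "(\<Sum>w\<in>?Z j. residue (gen_fun S a t) w) =
        fourier_dedekind t (S - {j}) (\<lambda>k. int (a k)) (a j)"
      by (simp add: fourier_dedekind_def sum_distrib_left)
  qed
  finally show ?thesis .
qed

theorem theorem3:
  fixes n t :: nat and a :: "nat \<Rightarrow> nat"
  assumes "n \<ge> 1"
    and "\<And>k. k \<in> {1..n} \<Longrightarrow> a k > 0"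
    and "\<And>i j. i \<in> {1..n} \<Longrightarrow> j \<in> {1..n} \<Longrightarrow> i \<noteq> j \<Longrightarrow> coprime (a i) (a j)"
    and "t > 0"
  shows "of_nat (pos_partition_count n a t) =
    res_term n a t +
    (\<Sum>j=1..n. fourier_dedekind (int t) ({1..n} - {j}) (\<lambda>k. int (a k)) (a j))"
proof -
  let ?S = "{1..n}"
  have S: "finite ?S" "?S \<noteq> {}"
    using assms(1) by auto
  have zero: "0 \<notin> root_poles ?S a"
    using norm_root_poles[of ?S a 0, OF assms(2)] by auto
  have "pos_solutions n a t = sols ?S a (int t)"
    unfolding pos_solutions_def sols_def of_nat_sum[symmetric] of_nat_eq_iff ..
  moreover have "gen_G n a t = gen_fun ?S a (int t)"
    by (simp add: gen_G_def gen_fun_def fun_eq_iff)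
  moreover have "2 * pi * \<i> * of_nat (card (sols ?S a (int t))) =
      2 * pi * \<i> * (\<Sum>w\<in>insert 0 (root_poles ?S a). residue (gen_fun ?S a (int t)) w)"
    \<comment> \<open>The radius 2 is an arbitrary choice above 1.\<close>
    using contour_integral_gen_fun_eq_card[of ?S a 2 "int t", OF S(1) assms(2)]
      contour_integral_gen_fun[of ?S a 2 "int t", OF S(1) assms(2)] by simp
  then have "of_nat (card (sols ?S a (int t))) =
      (\<Sum>w\<in>root_poles ?S a. residue (gen_fun ?S a (int t)) w)"
    using residue_gen_fun_0[of ?S a "int t", OF S(1) assms(2)] assms(4) zero
      finite_root_poles[of ?S a, OF S(1) assms(2)] by simp
  ultimately show ?thesis
    using sum_residue_gen_fun[of ?S a "int t", OF S assms(2,3)]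
    by (simp add: pos_partition_count_def res_term_def)
qed

end
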